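(* Let $K_{m,n}$ be the complete bipartite graph with $m,n\geq 2$. Then for any edge $e$ of $K_{m,n}$, $$E_{\varepsilon}(K_{m,n})<E_{\varepsilon}(K_{m,n}-e).$$
   Context: All graphs are finite, simple and connected. For a connected graph $G$, $d_G(u,v)$ is the length of a shortest $u$–$v$ path, and the eccentricity of a vertex $u$ is $e(u)=\max\{d_G(u,v): v\in V(G)\}$. The eccentricity matrix $\varepsilon(G)$ is the $|V(G)|\times|V(G)|$ matrix indexed by $V(G)$ with $\varepsilon(G)_{uv}=d_G(u,v)$ if $d_G(u,v)=\min\{e(u),e(v)\}$ and $\varepsilon(G)_{uv}=0$ otherwise. The eccentricity energy of $G$ is $E_{\varepsilon}(G)=\sum_i|\xi_i|$, where $\xi_i$ are the eigenvalues of $\varepsilon(G)$. $G-e$ denotes the graph obtained from $G$ by deleting the edge $e$ (keeping all vertices). *)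

theory Defs
  imports
    "Graph_Theory.Kuratowski"
    "Jordan_Normal_Form.Char_Poly"
    "HOL-Library.Countable_Set"
begin

text \<open>
  Finite simple graphs are the symmetric digraphs of the locale \<^locale>\<open>graph\<close>: an undirected
  edge is a pair of opposite arcs. The length of a path is its number of arcs. All notions below
  are meant for connected graphs; in a disconnected graph \<open>LEAST\<close> is taken over an empty set
  for vertices in different components.
\<close>

definition gdist :: "('a, 'b) pre_digraph \<Rightarrow> 'a \<Rightarrow> 'a \<Rightarrow> nat" where
  "gdist G u v = (LEAST k. \<exists>p. pre_digraph.apath G u p v \<and> length p = k)"

definition eccentricity :: "('a, 'b) pre_digraph \<Rightarrow> 'a \<Rightarrow> nat" where
  "eccentricity G u = Max {gdist G u v | v. v \<in> verts G}"

definition ecc_entry :: "('a, 'b) pre_digraph \<Rightarrow> 'a \<Rightarrow> 'a \<Rightarrow> real" where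
  "ecc_entry G u v =
    (if gdist G u v = min (eccentricity G u) (eccentricity G v) then real (gdist G u v) else 0)"

text \<open>
  Matrices are indexed by natural numbers, so the vertices are numbered by the bijection
  \<^term>\<open>from_nat_into (verts G)\<close> from \<^term>\<open>{..<card (verts G)}\<close> onto the finite set
  \<^term>\<open>verts G\<close>. Another numbering conjugates the matrix by a permutation matrix and leaves the
  energy unchanged.
\<close>

definition ecc_matrix :: "('a, 'b) pre_digraph \<Rightarrow> real mat" where
  "ecc_matrix G = mat (card (verts G)) (card (verts G))
    (\<lambda>(i, j). ecc_entry G (from_nat_into (verts G) i) (from_nat_into (verts G) j))"

text \<open>
  The eigenvalues are counted with algebraic multiplicity. They are taken over the complex numbers,
  so that none is lost and the definition does not rely on the symmetry of the matrix.
\<close>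

definition mat_energy :: "complex mat \<Rightarrow> real" where
  "mat_energy A =
    (\<Sum>\<xi> | eigenvalue A \<xi>. real (Polynomial.order \<xi> (char_poly A)) * cmod \<xi>)"

definition ecc_energy :: "('a, 'b) pre_digraph \<Rightarrow> real" where
  "ecc_energy G = mat_energy (map_mat complex_of_real (ecc_matrix G))"

text \<open>Deleting the undirected edge represented by the arc \<open>e\<close> removes \<open>e\<close> and its reverse.\<close>

definition del_edge :: "('a, 'b) pre_digraph \<Rightarrow> 'b \<Rightarrow> ('a, 'b) pre_digraph" where
  "del_edge G e = G\<lparr>arcs := {a \<in> arcs G. {tail G a, head G a} \<noteq> {tail G e, head G e}}\<rparr>"

end

theory Submission
  imports Defs
begin

text \<open>
  In \<open>K\<^sub>m\<^sub>,\<^sub>n\<close> all eccentricities are 2, so the eccentricity matrix has the entry 2 at pairs of distinct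
  vertices of the same part and 0 elsewhere. Deleting the edge \<open>xy\<close> makes \<open>d(x, y) = e(x) = e(y) = 3\<close>
  and changes nothing but the entries at \<open>(x, y)\<close> and \<open>(y, x)\<close>, which become 3. Let
  \<open>a = m - 2\<close>, \<open>b = n - 2\<close>, and let \<open>c\<close> be this entry, 0 or 3. The differences of two vertices of
  the same part other than \<open>x\<close> and \<open>y\<close> are eigenvectors for \<open>-2\<close>, and splitting them off leaves a
  \<open>4 \<times> 4\<close> matrix, so the characteristic polynomial is \<open>(X + 2)\<^sup>a\<^sup>+\<^sup>b\<close> times
  \<open>(X + 2)\<^sup>2 (X - 2(a + 1)) (X - 2(b + 1)) - c\<^sup>2 (X - 2a) (X - 2b)\<close>.
  For \<open>c = 0\<close> the energy is \<open>4(a + b) + 8\<close>. For \<open>c = 3\<close> and \<open>a + b > 0\<close> the quartic is negative at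
  \<open>-4\<close> and nonnegative at \<open>-5\<close>, so it has a root \<open>r < -4\<close>. As its roots have sum \<open>2(a + b)\<close>, their absolute
  values have sum at least \<open>2(a + b) - 2r > 2(a + b) + 8\<close>. For \<open>a = b = 0\<close> the roots are
  \<open>\<plusminus>1\<close> and \<open>\<plusminus>4\<close>.
\<close>

subsection \<open>Energy and linear factors\<close>

lemma order_linear_factors:
  "Polynomial.order x (\<Prod>a\<leftarrow>as. [:- a, 1:]) = count_list as (x :: 'a :: idom)"
proof (induction as)
  case (Cons a as)
  have "(\<Prod>a\<leftarrow>as. [:- a, 1:]) \<noteq> 0"
    by (auto simp del: mult_pCons_left simp: prod_list_zero_iff)
  then have "[:- a, 1:] * (\<Prod>a\<leftarrow>as. [:- a, 1:]) \<noteq> 0"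
    by (intro no_zero_divisors) simp_all
  then have "Polynomial.order x (\<Prod>a\<leftarrow>a # as. [:- a, 1:]) =
      Polynomial.order x [:- a, 1:] + Polynomial.order x (\<Prod>a\<leftarrow>as. [:- a, 1:])"
    by (simp only: list.map prod_list.Cons) (rule Polynomial.order_mult)
  moreover have "Polynomial.order x [:- a, 1:] = (if a = x then 1 else 0)"
    using order_power_n_n[of x 1] by (cases "a = x") (simp_all add: order_0I)
  ultimately show ?case using Cons.IH by simp
qed simp

lemma sum_list_map_eq_sum_of_nat_count:
  assumes "finite X" "set xs \<subseteq> X"
  shows "(\<Sum>x\<leftarrow>xs. f x) = (\<Sum>x\<in>X. of_nat (count_list xs x) * (f x :: 'a :: semiring_1))"
  using assms(2)
proof (induction xs)
  case (Cons a xs)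
  have "(\<Sum>x\<in>X. of_nat (count_list (a # xs) x) * f x) =
      (\<Sum>x\<in>X. (if x = a then f x else 0) + of_nat (count_list xs x) * f x)"
    by (rule sum.cong) (auto simp: distrib_right)
  also have "\<dots> = f a + (\<Sum>x\<in>X. of_nat (count_list xs x) * f x)"
    using assms(1) Cons.prems by (simp add: sum.distrib)
  finally show ?case using Cons by simp
qed simp

text \<open>The order of a root in a product of linear factors is its number of occurrences in the
  list, so energies can be read off a factorization.\<close>

lemma mat_energy_linear_factors:
  assumes A: "A \<in> carrier_mat n n"
    and p: "char_poly A = (\<Prod>a\<leftarrow>as. [:- a, 1:])"
  shows "mat_energy A = (\<Sum>a\<leftarrow>as. cmod a)"
proof -
  have "{x. eigenvalue A x} = set as"
    unfolding eigenvalue_root_char_poly[OF A] p by (auto simp: poly_prod_list prod_list_zero_iff)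
  then have "mat_energy A = (\<Sum>x\<in>set as. real (count_list as x) * cmod x)"
    by (simp add: mat_energy_def p order_linear_factors)
  then show ?thesis
    using sum_list_map_eq_sum_of_nat_count[of "set as" as cmod] by simp
qed

subsection \<open>The characteristic polynomial\<close>

text \<open>Laplace expansion along the first column, with minors that are again explicit
  \<open>mat\<close> terms, so that rewriting can unfold a concrete size.\<close>

lemma det_mat_Suc:
  "det (mat (Suc n) (Suc n) f) = (\<Sum>i<Suc n. f (i, 0) * ((-1) ^ i *
     det (mat n n (\<lambda>(i', j). f (if i' < i then i' else Suc i', Suc j)))) :: 'a :: comm_ring_1)"
proof -
  have "mat_delete (mat (Suc n) (Suc n) f) i 0 =
      mat n n (\<lambda>(i', j). f (if i' < i then i' else Suc i', Suc j))" for i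
    by (rule eq_matI) (auto simp: mat_delete_def)
  then show ?thesis
    by (simp only: laplace_expansion_column[of "mat (Suc n) (Suc n) f" "Suc n" 0] mat_carrier
        cofactor_def) simp
qed

text \<open>Two \<open>2 x 2\<close> blocks are coupled only by \<open>r\<close>: a nonzero term
  uses either no \<open>r\<close>, or both, leaving \<open>t\<close> and \<open>w\<close> with the
  sign of a transposition.\<close>

lemma det_coupled_pairs:
  "det (mat 4 4 (\<lambda>(i, j). [[p, q, r, 0], [s, t, 0, 0], [r, 0, p, q], [0, 0, u, w]] ! i ! j)) =
    (p * t - q * s) * (p * w - q * u) - r * r * t * (w :: 'a :: comm_ring_1)"
proof -
  have 4: "(4 :: nat) = Suc (Suc (Suc (Suc 0)))" by simp
  show ?thesis unfolding 4
    by (simp add: det_mat_Suc) (simp add: algebra_simps)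
qed

text \<open>The indices 0 and 2 are the ends \<open>x\<close>, \<open>y\<close> of the edge; \<open>s\<close> selects the part containing \<open>x\<close>.\<close>

definition linked_cliques :: "'a :: comm_ring_1 \<Rightarrow> (nat \<Rightarrow> bool) \<Rightarrow> nat \<Rightarrow> nat \<Rightarrow> 'a" where
  "linked_cliques c s i j =
    (if i = j then 0 else if s i = s j then 2 else if {i, j} = {0, 2} then c else 0)"

lemma char_poly_linked_cliques:
  fixes c :: "'a :: field"
  assumes s: "s 0" "s 1" "\<not> s 2" "\<not> s 3"
    and a: "card {i \<in> {4..<n}. s i} = a" and b: "card {i \<in> {4..<n}. \<not> s i} = b" and n: "n = k + 4"
  shows "char_poly (mat n n (\<lambda>(i, j). linked_cliques c s i j)) =
    ([:2, 1:] ^ 2 * [:- 2 * of_nat (a + 1), 1:] * [:- 2 * of_nat (b + 1), 1:]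
      - [:c:] ^ 2 * [:- 2 * of_nat a, 1:] * [:- 2 * of_nat b, 1:]) * [:2, 1:] ^ k"
proof -
  note s = s s(2)[unfolded One_nat_def]
  let ?B = "mat n n (\<lambda>(i, j). linked_cliques c s i j)"
  \<comment> \<open>The representatives 1 and 3 avoid the ends 0 and 2, so \<open>c\<close> never
    enters the images of the differences.\<close>
  define t where "t i = (if s i then 1 else 3 :: nat)" for i
  \<comment> \<open>Change of basis: for \<open>j \<ge> 4\<close>, replace \<open>e\<^sub>j\<close> by \<open>e\<^sub>j - e\<^sub>1\<close> or \<open>e\<^sub>j - e\<^sub>3\<close>, an eigenvector for \<open>-2\<close>.\<close>
  let ?P = "mat n n (\<lambda>(i, j). (if i = j then 1 else 0) - (if 4 \<le> j \<and> i = t j then 1 else 0) :: 'a)"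
  let ?Q = "mat n n (\<lambda>(i, j). (if i = j then 1 else 0) + (if 4 \<le> j \<and> i = t j then 1 else 0) :: 'a)"
  \<comment> \<open>As \<open>e_i = (e_i - e_(t i)) + e_(t i)\<close>, row \<open>t i\<close>
    absorbs every row \<open>i >= 4\<close>. This adds \<open>2a\<close> to row 1 and
    \<open>2b\<close> to row 3, in the columns below 4 of their own part.\<close>
  define C where "C i j = (if 4 \<le> j then (if i = j then - 2 else 0)
      else linked_cliques c s i j +
        (if i = 1 then (if j < 2 then 2 * of_nat a else 0)
         else if i = 3 then (if j < 2 then 0 else 2 * of_nat b) else 0))" for i j
  let ?C = "mat n n (\<lambda>(i, j). C i j)"
  have t: "t i = 1 \<or> t i = 3" "t i < n" "\<not> 4 \<le> t i" for i
    using n by (auto simp: t_def)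
  have mult_P: "(\<Sum>k = 0..<n. f k * ((if k = j then 1 else 0) - (if 4 \<le> j \<and> k = t j then 1 else 0))) =
      f j - (if 4 \<le> j then f (t j) else 0)" if "j < n" for j and f :: "nat \<Rightarrow> 'a"
    using that t by (auto simp: right_diff_distrib sum_subtractf if_distrib[of "\<lambda>x. _ * x"] cong: if_cong)
  have Q_mult: "(\<Sum>k = 0..<n. ((if i = k then 1 else 0) + (if 4 \<le> k \<and> i = t k then 1 else 0)) * f k) =
      f i + (\<Sum>k \<in> {k \<in> {4..<n}. t k = i}. f k)" if "i < n" for i and f :: "nat \<Rightarrow> 'a"
  proof -
    have "(\<Sum>k = 0..<n. (if 4 \<le> k \<and> i = t k then 1 else 0) * f k) =
        (\<Sum>k \<in> {k \<in> {4..<n}. t k = i}. f k)"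
      by (rule sum.mono_neutral_cong_right) auto
    then show ?thesis
      using that by (auto simp: distrib_right sum.distrib if_distrib[of "\<lambda>x. x * _"] cong: if_cong)
  qed
  \<comment> \<open>\<open>?P = I - N\<close> and \<open>?Q = I + N\<close> with
    \<open>N * N = 0\<close>, since \<open>t j < 4\<close> while \<open>N\<close> vanishes in the
    columns below 4.\<close>
  have QP: "?Q * ?P = 1\<^sub>m n"
  proof (rule eq_matI, goal_cases)
    case (1 i j)
    have "(\<Sum>k = 0..<n. ((if i = k then 1 else 0) + (if 4 \<le> k \<and> i = t k then 1 else 0)) *
       ((if k = j then 1 else 0) - (if 4 \<le> j \<and> k = t j then 1 else 0))) =
      (if i = j then 1 else (0 :: 'a))"
      using 1 t by (subst mult_P) auto
    then show ?case using 1 by (simp add: scalar_prod_def)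
  qed auto
  then have PQ: "?P * ?Q = 1\<^sub>m n"
    by (intro mat_mult_left_right_inverse[of ?Q n ?P]) auto
  have less4: "i = 0 \<or> i = 1 \<or> i = 2 \<or> i = 3 \<or> 4 \<le> i" for i :: nat
    by arith
  have BP: "?B * ?P = mat n n (\<lambda>(i, j). linked_cliques c s i j - (if 4 \<le> j then linked_cliques c s i (t j) else 0))"
    by (rule eq_matI) (auto simp: scalar_prod_def mult_P)
  have ts: "{k \<in> {4..<n}. t k = i} = (if i = 1 then {i \<in> {4..<n}. s i} else
      if i = 3 then {i \<in> {4..<n}. \<not> s i} else {})" for i
    by (auto simp: t_def)
  have "?C = ?Q * (?B * ?P)"
    unfolding BP
  proof (rule eq_matI, goal_cases)
    case (1 i j)
    have "C i j = linked_cliques c s i j - (if 4 \<le> j then linked_cliques c s i (t j) else 0) +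
       (\<Sum>k \<in> {k \<in> {4..<n}. t k = i}. linked_cliques c s k j - (if 4 \<le> j then linked_cliques c s k (t j) else 0))"
    proof (cases "4 \<le> j")
      case True
      have sub: "linked_cliques c s k j - linked_cliques c s k (t j) = (if k = j then - 2 else 0)"
        if "4 \<le> k" for k
        using that True t[of j] by (auto simp: linked_cliques_def t_def s doubleton_eq_iff)
      have "(\<Sum>k \<in> {k \<in> {4..<n}. t k = i}. linked_cliques c s k j - linked_cliques c s k (t j)) =
          (\<Sum>k \<in> {k \<in> {4..<n}. t k = i}. if k = j then - 2 else 0)"
        by (rule sum.cong) (auto simp: sub)
      also have "\<dots> = (if t j = i then - 2 else 0)"
        using 1 True by auto
      \<comment> \<open>For \<open>i = t j\<close> this \<open>-2\<close> cancels the
        \<open>2\<close> left by the zero diagonal entry at \<open>(t j, t j)\<close>.\<close>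
      finally show ?thesis
        using True sub[of i] s less4[of i]
        by (auto simp: C_def linked_cliques_def t_def doubleton_eq_iff)
    next
      case False
      have "(\<Sum>k \<in> {k \<in> {4..<n}. t k = i}. linked_cliques c s k j) =
          (\<Sum>k \<in> {k \<in> {4..<n}. t k = i}. if s j = (i = 1) then 2 else 0)"
        using False by (intro sum.cong) (auto simp: linked_cliques_def t_def doubleton_eq_iff)
      also have "\<dots> = (if s j = (i = 1) then 2 else 0) * of_nat (card {k \<in> {4..<n}. t k = i})"
        by simp
      also have "card {k \<in> {4..<n}. t k = i} = (if i = 1 then a else if i = 3 then b else 0)"
        unfolding ts using a b by simp
      finally show ?thesis
        using False less4[of j] s by (auto simp: C_def)
    qed
    then show ?case using 1 by (simp add: scalar_prod_def Q_mult)
  qed auto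
  then have "?C = ?Q * ?B * ?P"
    by (simp add: assoc_mult_mat[of _ n n _ n _ n])
  then have sim: "char_poly ?B = char_poly ?C"
    using PQ QP by (intro char_poly_similar[symmetric] similar_matI[of _ _ ?Q ?P n]) auto
  \<comment> \<open>Columns of \<open>C\<close> from 4 on are \<open>-2\<close> times unit vectors,
    so the matrix is block lower triangular and its determinant is that of the \<open>4 x 4\<close>
    block times \<open>(X + 2)^k\<close>.\<close>
  have "char_poly_matrix ?C = four_block_mat
      (mat 4 4 (\<lambda>(i, j). [[[:0, 1:], [:-2:], [:-c:], 0], [[:- 2 * of_nat (a + 1):], [:- 2 * of_nat a, 1:], 0, 0],
         [[:-c:], 0, [:0, 1:], [:-2:]], [0, 0, [:- 2 * of_nat (b + 1):], [:- 2 * of_nat b, 1:]]] ! i ! j))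
      (0\<^sub>m 4 k) (mat k 4 (\<lambda>(i, j). [:- C (i + 4) j:])) ([:2, 1:] \<cdot>\<^sub>m 1\<^sub>m k)"
  proof (rule eq_matI, goal_cases)
    case (1 i j)
    then have "i < n" "j < n" by (simp_all add: n)
    then have entry: "char_poly_matrix ?C $$ (i, j) = (if i = j then [:- C i j, 1:] else [:- C i j:])"
      by (simp add: char_poly_matrix_def)
    consider "4 \<le> i" "4 \<le> j" | "4 \<le> i" "j < 4" | "i < 4" "4 \<le> j" | "i < 4" "j < 4"
      by linarith
    then show ?case
    proof cases
      case 4
      have "i = 0 \<or> i = 1 \<or> i = 2 \<or> i = 3" "j = 0 \<or> j = 1 \<or> j = 2 \<or> j = 3"
        using 4 less4[of i] less4[of j] by linarith+
      then show ?thesis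
        unfolding entry by (elim disjE) (simp_all add: C_def linked_cliques_def s doubleton_eq_iff)
    qed (unfold entry, use \<open>i < n\<close> \<open>j < n\<close> in \<open>simp_all add: C_def n eq_diff_iff\<close>)
  qed (auto simp: n char_poly_matrix_def)
  then have "char_poly ?C = (([:0, 1:] * [:- 2 * of_nat a, 1:] - [:-2:] * [:- 2 * of_nat (a + 1):]) *
      ([:0, 1:] * [:- 2 * of_nat b, 1:] - [:-2:] * [:- 2 * of_nat (b + 1):]) - [:-c:] * [:-c:] *
      [:- 2 * of_nat a, 1:] * [:- 2 * of_nat b, 1:]) * [:2, 1:] ^ k"
    unfolding char_poly_def
    by (simp add: det_four_block_mat_upper_right_zero[where n = 4 and m = k] det_coupled_pairs)
  \<comment> \<open>One part alone contributes \<open>X (X - 2m) - 4 (m + 1)\<close>, with roots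
    \<open>-2\<close> and \<open>2 (m + 1)\<close>.\<close>
  moreover have "[:0, 1:] * [:- 2 * of_nat m, 1:] - [:-2:] * [:- 2 * of_nat (m + 1):] = [:2, 1:] * [:- 2 * of_nat (m + 1), 1 :: 'a:]" for m
    by (simp add: algebra_simps)
  moreover have "[:- c:] * [:- c:] = [:c:] ^ 2"
    by (simp add: power2_eq_square)
  ultimately show ?thesis
    using sim by (simp only: power2_eq_square mult_ac)
qed

text \<open>The permutation matrix matching the two numberings conjugates one matrix into the other.
  This allows a numbering adapted to the edge in place of \<open>from_nat_into\<close>.\<close>

lemma char_poly_reindex:
  fixes F :: "'v \<Rightarrow> 'v \<Rightarrow> 'a :: comm_ring_1"
  assumes g: "bij_betw g {..<n} S" and h: "bij_betw h {..<n} S"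
  shows "char_poly (mat n n (\<lambda>(i, j). F (g i) (g j))) = char_poly (mat n n (\<lambda>(i, j). F (h i) (h j)))"
proof (rule char_poly_similar, rule similar_matI)
  let ?P = "mat n n (\<lambda>(i, j). if g i = h j then 1 else (0 :: 'a))"
  let ?Q = "mat n n (\<lambda>(i, j). if h i = g j then 1 else (0 :: 'a))"
  let ?A = "mat n n (\<lambda>(i, j). F (g i) (g j))" and ?B = "mat n n (\<lambda>(i, j). F (h i) (h j))"
  have fin: "finite S" using g bij_betw_finite by blast
  have gS: "g i \<in> S" and hS: "h i \<in> S" if "i < n" for i
    using that g h by (auto simp: bij_betw_def)
  have sg: "(\<Sum>k = 0..<n. f (g k)) = sum f S" and sh: "(\<Sum>k = 0..<n. f (h k)) = sum f S"
    for f :: "'v \<Rightarrow> 'a"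
    using sum.reindex_bij_betw[OF g, of f] sum.reindex_bij_betw[OF h, of f]
    by (simp_all add: lessThan_atLeast0)
  have ig: "g i = g j \<longleftrightarrow> i = j" and ih: "h i = h j \<longleftrightarrow> i = j" if "i < n" "j < n" for i j
    using that g h by (auto simp: bij_betw_def inj_on_def)
  show "{?A, ?B, ?P, ?Q} \<subseteq> carrier_mat n n" by auto
  have "(\<Sum>k = 0..<n. (if g i = h k then 1 else 0) * (if h k = g j then 1 else 0)) =
      (if i = j then 1 else (0 :: 'a))" if "i < n" "j < n" for i j
    using that sh[of "\<lambda>x. (if g i = x then 1 else 0) * (if x = g j then 1 else 0)"] fin gS ig by (auto simp: if_distrib[of "\<lambda>x. x * _"] cong: if_cong)
  then show "?P * ?Q = 1\<^sub>m n"
    by (intro eq_matI) (simp_all add: scalar_prod_def)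
  have "(\<Sum>k = 0..<n. (if h i = g k then 1 else 0) * (if g k = h j then 1 else 0)) =
      (if i = j then 1 else (0 :: 'a))" if "i < n" "j < n" for i j
    using that sg[of "\<lambda>x. (if h i = x then 1 else 0) * (if x = h j then 1 else 0)"] fin hS ih by (auto simp: if_distrib[of "\<lambda>x. x * _"] cong: if_cong)
  then show "?Q * ?P = 1\<^sub>m n"
    by (intro eq_matI) (simp_all add: scalar_prod_def)
  have PB: "?P * ?B = mat n n (\<lambda>(i, j). F (g i) (h j))"
    using fin gS sh[of "\<lambda>x. (if g _ = x then 1 else 0) * F x (h _)"]
    by (intro eq_matI) (auto simp: scalar_prod_def if_distrib[of "\<lambda>x. x * _"] cong: if_cong)
  show "?A = ?P * ?B * ?Q"
    unfolding PB using fin gS sh[of "\<lambda>x. F (g _) x * (if x = g _ then 1 else 0)"]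
    by (intro eq_matI) (auto simp: scalar_prod_def if_distrib[of "\<lambda>x. _ * x"] cong: if_cong)
qed

subsection \<open>The two energies\<close>

lemma mat_energy_unlinked:
  assumes A: "A \<in> carrier_mat n n"
    and p: "char_poly A = [:2, 1:] ^ 2 * [:- 2 * of_nat (a + 1), 1:] * [:- 2 * of_nat (b + 1), 1:] * [:2, 1:] ^ (a + b)"
  shows "mat_energy A = 4 * real (a + b) + 8"
proof -
  let ?as = "[- 2, - 2, 2 * of_nat (a + 1), 2 * of_nat (b + 1)] @ replicate (a + b) (- 2)"
  have cp: "char_poly A = (\<Prod>a\<leftarrow>?as. [:- a, 1:])"
    unfolding p by (simp add: power2_eq_square prod_list_replicate mult_ac del: mult_pCons_left mult_pCons_right)
  have "cmod (2 * of_nat (m + 1)) = 2 * real (m + 1)" for m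
    by (simp only: norm_mult norm_of_nat) simp
  then have "mat_energy A = 4 + 2 * real (a + 1) + 2 * real (b + 1) + 2 * real (a + b)"
    unfolding mat_energy_linear_factors[OF A cp]
    by (simp add: sum_list_replicate del: of_nat_add of_nat_Suc)
  then show ?thesis by simp
qed

text \<open>The threshold is \<open>-4\<close> because the modulus of such a root exceeds its value
  by more than 8.\<close>

lemma linked_quartic_root:
  assumes "a + b > 0"
  obtains r :: real where "r < - 4"
    "(r + 2) ^ 2 * (r - 2 * real (a + 1)) * (r - 2 * real (b + 1)) = 9 * (r - 2 * real a) * (r - 2 * real b)"
proof -
  define f where "f x = (x + 2) ^ 2 * (x - 2 * real (a + 1)) * (x - 2 * real (b + 1))
    - 9 * (x - 2 * real a) * (x - 2 * real b)" for x
  \<comment> \<open>The constants 144 cancel: for \<open>a = b = 0\<close>, \<open>-4\<close> is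
    itself a root, and \<open>a + b > 0\<close> makes the value negative.\<close>
  have "f (- 4) = - (20 * (real a * real b) + 24 * real (a + b))"
    by (simp add: f_def algebra_simps)
  moreover have "0 < 20 * (real a * real b) + 24 * real (a + b)"
    using assms by (intro add_nonneg_pos) auto
  ultimately have neg: "f (- 4) < 0"
    by (simp only: neg_less_0_iff_less)
  \<comment> \<open>At \<open>-5\<close> the square \<open>(x + 2)^2\<close> equals 9, so the factor
    9 comes out of both terms.\<close>
  have "f (- 5) = 36 * real (a + b) + 216"
    by (simp add: f_def algebra_simps)
  then have pos: "f (- 5) \<ge> 0"
    by simp
  have "continuous_on {- 5..- 4} f"
    unfolding f_def by (intro continuous_intros)
  then obtain r where r: "- 5 \<le> r" "r \<le> - 4" "f r = 0"
    using IVT2'[of f "- 4" 0 "- 5"] neg pos by auto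
  then have "r \<noteq> - 4"
    using neg by auto
  then show ?thesis
    using r unfolding f_def by (intro that[of r]) auto
qed

text \<open>For \<open>a + b > 0\<close>, the sum of the quartic's roots and one root suffice:
  \<open>|z| >= Re z\<close> bounds the others, real or not.\<close>

lemma mat_energy_linked:
  assumes A: "A \<in> carrier_mat n n"
    and p: "char_poly A = ([:2, 1:] ^ 2 * [:- 2 * of_nat (a + 1), 1:] * [:- 2 * of_nat (b + 1), 1:]
      - [:3:] ^ 2 * [:- 2 * of_nat a, 1:] * [:- 2 * of_nat b, 1:]) * [:2, 1:] ^ (a + b)"
  shows "mat_energy A > 4 * real (a + b) + 8"
proof -
  define q :: "complex poly" where "q = [:2, 1:] ^ 2 * [:- 2 * of_nat (a + 1), 1:] * [:- 2 * of_nat (b + 1), 1:]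
      - [:3:] ^ 2 * [:- 2 * of_nat a, 1:] * [:- 2 * of_nat b, 1:]"
  have energy: "mat_energy A = (\<Sum>a\<leftarrow>as. cmod a) + 2 * real (a + b)"
    if "q = (\<Prod>a\<leftarrow>as. [:- a, 1:])" for as
  proof -
    have "char_poly A = (\<Prod>a\<leftarrow>as @ replicate (a + b) (- 2). [:- a, 1:])"
      unfolding p q_def[symmetric] that by (simp add: prod_list_replicate)
    then show ?thesis
      by (simp only: mat_energy_linear_factors[OF A]) (simp add: sum_list_replicate)
  qed
  show ?thesis
  proof (cases "a + b = 0")
    case True
    \<comment> \<open>\<open>(X^2 - 4)^2 - 9 X^2\<close> is a difference of squares; the energy is
      10, against 8.\<close>
    then have q: "q = (\<Prod>a\<leftarrow>[1, - 1, 4, - 4]. [:- a, 1:])"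
      by (simp add: q_def power2_eq_square)
    then show ?thesis
      using energy[OF q] True by simp
  next
    case False
    \<comment> \<open>The subtracted term has degree 2, so it does not affect the sum of the
      roots.\<close>
    have q: "q = [:coeff q 0, coeff q 1, coeff q 2, - 2 * of_nat (a + b), 1:]"
      by (simp add: q_def power2_eq_square algebra_simps numeral_2_eq_2)
    have deg: "degree q = 4" "coeff q 4 = 1"
      by (subst q, simp add: numeral_eq_Suc)+
    obtain as where "Polynomial.smult (coeff q (degree q)) (\<Prod>a\<leftarrow>as. [:- a, 1:]) = q"
        "length as = degree q"
      using fundamental_theorem_algebra_factorized[of q] by blast
    then have as: "q = (\<Prod>a\<leftarrow>as. [:- a, 1:])" "length as = 4"
      by (simp_all add: deg)
    then obtain z1 z2 z3 z4 where z: "as = [z1, z2, z3, z4]"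
      by (auto simp: numeral_eq_Suc length_Suc_conv)
    have "z1 + z2 + z3 + z4 = 2 * of_nat (a + b)"
      using as(1) q unfolding z by (simp add: algebra_simps)
    then have sum: "Re z1 + Re z2 + Re z3 + Re z4 = 2 * real (a + b)"
      by (metis plus_complex.simps(1) Re_complex_of_real of_real_of_nat_eq of_real_mult of_real_numeral)
    have "a + b > 0"
      using False by simp
    then obtain r where r: "r < - 4" "(r + 2) ^ 2 * (r - 2 * real (a + 1)) * (r - 2 * real (b + 1)) =
       9 * (r - 2 * real a) * (r - 2 * real b)"
      by (rule linked_quartic_root)
    have "poly q (of_real r) = of_real ((r + 2) ^ 2 * (r - 2 * real (a + 1)) * (r - 2 * real (b + 1)) -
       9 * (r - 2 * real a) * (r - 2 * real b))"
      by (simp add: q_def power2_eq_square algebra_simps)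
    then have "poly q (of_real r) = 0"
      by (simp only: r(2) diff_self of_real_0)
    then have "of_real r \<in> set as"
      unfolding as(1) by (auto simp: poly_prod_list prod_list_zero_iff)
    then have "of_real r \<in> {z1, z2, z3, z4}"
      by (simp add: z)
    moreover have "cmod (of_real r) = - r" "Re (of_real r) = r"
      using r by auto
    \<comment> \<open>The root \<open>r\<close> gains \<open>-2r > 8\<close> over its real part, the
      others at least 0.\<close>
    ultimately have "cmod z1 + cmod z2 + cmod z3 + cmod z4 > 2 * real (a + b) + 8"
      using sum r complex_Re_le_cmod[of z1] complex_Re_le_cmod[of z2] complex_Re_le_cmod[of z3] complex_Re_le_cmod[of z4]
      by auto
    then show ?thesis
      using energy[OF as(1)] by (simp add: z)
  qed
qed

subsection \<open>Eccentricities\<close>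

context wf_digraph
begin

lemma gdist_eqI:
  assumes "apath u p v" "\<And>q. apath u q v \<Longrightarrow> length p \<le> length q"
  shows "gdist G u v = length p"
  unfolding gdist_def using assms by (intro Least_equality) auto

lemma apath_Nil_ends: "apath u [] v \<Longrightarrow> u = v"
  by (simp add: apath_Nil_iff)

lemma apath_1_dominates: "apath u [e] v \<Longrightarrow> u \<rightarrow>\<^bsub>G\<^esub> v"
  by (auto simp: apath_simps arcs_ends_conv)

lemma apath_2_dominates: "apath u [e, f] v \<Longrightarrow> \<exists>w. u \<rightarrow>\<^bsub>G\<^esub> w \<and> w \<rightarrow>\<^bsub>G\<^esub> v"
  by (auto simp: apath_simps arcs_ends_conv)

lemma gdist_self: "u \<in> verts G \<Longrightarrow> gdist G u u = 0"
  using gdist_eqI[of u "[]" u] by (simp add: apath_Nil_iff)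

lemma gdist_1:
  assumes "u \<noteq> v" "u \<rightarrow>\<^bsub>G\<^esub> v"
  shows "gdist G u v = 1"
proof -
  obtain e where "e \<in> arcs G" "tail G e = u" "head G e = v"
    using assms by blast
  then have "apath u [e] v"
    using assms by (auto simp: apath_simps)
  then have "gdist G u v = length [e]"
  proof (rule gdist_eqI)
    show "length [e] \<le> length q" if "apath u q v" for q
      using that assms by (cases q) (auto dest: apath_Nil_ends)
  qed
  then show ?thesis by simp
qed

lemma gdist_2:
  assumes "u \<noteq> v" "\<not> u \<rightarrow>\<^bsub>G\<^esub> v" "u \<rightarrow>\<^bsub>G\<^esub> w" "w \<rightarrow>\<^bsub>G\<^esub> v"
  shows "gdist G u v = 2"
proof -
  obtain e f where "e \<in> arcs G" "tail G e = u" "head G e = w" "f \<in> arcs G" "tail G f = w" "head G f = v"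
    using assms(3,4) by blast
  then have "apath u [e, f] v"
    using assms by (auto simp: apath_simps)
  then have "gdist G u v = length [e, f]"
  proof (rule gdist_eqI)
    show "length [e, f] \<le> length q" if "apath u q v" for q
    \<comment> \<open>\<open>remdups_adj.cases\<close> serves only as the split into
      \<open>[]\<close>, a singleton and at least two elements.\<close>
    proof (cases q rule: remdups_adj.cases)
      case 1
      then show ?thesis using that assms(1) apath_Nil_ends by blast
    next
      case (2 e)
      then show ?thesis using that assms(2) apath_1_dominates by blast
    qed simp
  qed
  then show ?thesis by simp
qed

lemma gdist_3:
  assumes "u \<noteq> v" "\<not> u \<rightarrow>\<^bsub>G\<^esub> v" "\<And>w. u \<rightarrow>\<^bsub>G\<^esub> w \<Longrightarrow> \<not> w \<rightarrow>\<^bsub>G\<^esub> v"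
    and "u \<rightarrow>\<^bsub>G\<^esub> w" "w \<rightarrow>\<^bsub>G\<^esub> z" "z \<rightarrow>\<^bsub>G\<^esub> v"
  shows "gdist G u v = 3"
proof -
  obtain e f g where "e \<in> arcs G" "tail G e = u" "head G e = w" "f \<in> arcs G" "tail G f = w" "head G f = z"
      "g \<in> arcs G" "tail G g = z" "head G g = v"
    using assms(4-6) by blast
  \<comment> \<open>The four vertices are distinct: a repetition would give a walk of length at most
    2 from \<open>u\<close> to \<open>v\<close>.\<close>
  then have "apath u [e, f, g] v"
    using assms by (auto simp: apath_simps)
  then have "gdist G u v = length [e, f, g]"
  proof (rule gdist_eqI)
    show "length [e, f, g] \<le> length q" if q: "apath u q v" for q
    proof (cases q rule: remdups_adj.cases)
      case 1
      then show ?thesis using q assms(1) apath_Nil_ends by blast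
    next
      case (2 e)
      then show ?thesis using q assms(2) apath_1_dominates by blast
    next
      case (3 e f r)
      then have "r \<noteq> []" using q assms(3) apath_2_dominates by blast
      then show ?thesis using 3 by (cases r) simp_all
    qed
  qed
  then show ?thesis by simp
qed

end

text \<open>The flag \<open>d\<close> tells whether the edge \<open>xy\<close> is deleted.\<close>

locale bipartite_minus_edge = wf_digraph G for G :: "('a, 'b) pre_digraph" (structure) +
  fixes U V :: "'a set" and x y :: 'a and d :: bool
  assumes verts: "verts G = U \<union> V" and disj: "U \<inter> V = {}"
    and card: "card U \<ge> 2" "card V \<ge> 2"
    and xy: "x \<in> U" "y \<in> V"
    and ends: "arcs_ends G = (U \<times> V \<union> V \<times> U) - (if d then {(x, y), (y, x)} else {})"
begin

lemma finite_parts: "finite U" "finite V" "finite (verts G)"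
  using card by (auto simp: verts intro: card_ge_0_finite)

lemma others:
  obtains x' y' where "x' \<in> U" "x' \<noteq> x" "y' \<in> V" "y' \<noteq> y"
proof -
  have "\<not> U \<subseteq> {x}" "\<not> V \<subseteq> {y}"
    using card card_mono[of "{x}" U] card_mono[of "{y}" V] by auto
  then show ?thesis using that by blast
qed

text \<open>Vertices of one part meet through \<open>y'\<close> or \<open>x'\<close>, which avoid
  the deleted edge; its ends are joined by the detour \<open>x, y', x', y\<close>.\<close>

lemma gdist_eq:
  assumes "u \<in> verts G" "v \<in> verts G"
  shows "gdist G u v = (if u = v then 0 else if (u \<in> U) = (v \<in> U) then 2
    else if d \<and> {u, v} = {x, y} then 3 else 1)"
proof -
  obtain x' y' where o: "x' \<in> U" "x' \<noteq> x" "y' \<in> V" "y' \<noteq> y"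
    by (rule others)
  consider "u = v" | "u \<noteq> v" "u \<in> U" "v \<in> U" | "u \<noteq> v" "u \<in> V" "v \<in> V"
    | "u \<noteq> v" "(u \<in> U) \<noteq> (v \<in> U)" "\<not> (d \<and> {u, v} = {x, y})" | "d" "u = x" "v = y" | "d" "u = y" "v = x"
    using assms by (auto simp: verts doubleton_eq_iff)
  then show ?thesis
  proof cases
    case 1
    then show ?thesis using assms by (simp add: gdist_self)
  next
    case 2
    then have "gdist G u v = 2"
      using o disj xy by (intro gdist_2[of _ _ y']) (auto simp: ends)
    then show ?thesis using 2 by simp
  next
    case 3
    then have "gdist G u v = 2"
      using o disj xy by (intro gdist_2[of _ _ x']) (auto simp: ends)
    then show ?thesis using 3 disj by auto
  next
    case 4
    then have "gdist G u v = 1"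
      using assms disj by (intro gdist_1) (auto simp: ends verts)
    then show ?thesis using 4 by auto
  next
    case 5
    then have "gdist G u v = 3"
      using o disj xy by (intro gdist_3[of _ _ y' x']) (auto simp: ends)
    then show ?thesis using 5 disj xy by auto
  next
    case 6
    then have "gdist G u v = 3"
      using o disj xy by (intro gdist_3[of _ _ x' y']) (auto simp: ends)
    then show ?thesis using 6 disj xy by auto
  qed
qed

lemma eccentricity_eq:
  assumes "u \<in> verts G"
  shows "eccentricity G u = (if d \<and> u \<in> {x, y} then 3 else 2)"
proof -
  obtain x' y' where o: "x' \<in> U" "x' \<noteq> x" "y' \<in> V" "y' \<noteq> y"
    by (rule others)
  have sides: "y \<notin> U" "y' \<notin> U"
    using o xy disj by auto
  \<comment> \<open>A farthest vertex: the opposite end if \<open>u\<close> is an end of the deleted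
    edge, otherwise another vertex of the same part.\<close>
  define w where "w = (if u \<in> {x, y} \<and> d then (if u = x then y else x)
    else if u \<in> U then (if u = x then x' else x) else (if u = y then y' else y))"
  have "w \<in> verts G"
    using o xy by (auto simp: w_def verts)
  moreover have "gdist G u w = (if d \<and> u \<in> {x, y} then 3 else 2)"
    unfolding gdist_eq[OF assms \<open>w \<in> verts G\<close>] using o xy sides by (auto simp: w_def doubleton_eq_iff)
  moreover have "gdist G u v \<le> (if d \<and> u \<in> {x, y} then 3 else 2)" if "v \<in> verts G" for v
    unfolding gdist_eq[OF assms that] by auto
  ultimately show ?thesis
    unfolding eccentricity_def using finite_parts(3) by (intro Max_eqI) force+
qed

text \<open>Distinct vertices of one part are not both ends of \<open>xy\<close>, so the minimum is
  2 and is attained; distance 1 never attains it.\<close>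

lemma ecc_entry_eq:
  assumes "u \<in> verts G" "v \<in> verts G"
  shows "ecc_entry G u v = (if u = v then 0 else if (u \<in> U) = (v \<in> U) then 2
    else if d \<and> {u, v} = {x, y} then 3 else 0)"
proof -
  let ?m = "min (eccentricity G u) (eccentricity G v)"
  have m: "?m = (if d \<and> u \<in> {x, y} \<and> v \<in> {x, y} then 3 else 2)"
    unfolding eccentricity_eq[OF assms(1)] eccentricity_eq[OF assms(2)] by simp
  have y: "y \<notin> U" using xy disj by auto
  consider "u = v" | "u \<noteq> v" "(u \<in> U) = (v \<in> U)" | "(u \<in> U) \<noteq> (v \<in> U)" by blast
  then show ?thesis
  proof cases
    case 1
    then show ?thesis unfolding ecc_entry_def m gdist_eq[OF assms] by simp
  next
    case 2
    then have "\<not> (d \<and> u \<in> {x, y} \<and> v \<in> {x, y})"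
      using xy y by blast
    then show ?thesis unfolding ecc_entry_def m gdist_eq[OF assms] using 2 by simp
  next
    case 3
    then have "u \<noteq> v" "u \<in> {x, y} \<and> v \<in> {x, y} \<longleftrightarrow> {u, v} = {x, y}"
      by blast+
    then show ?thesis unfolding ecc_entry_def m gdist_eq[OF assms] using 3 by simp
  qed
qed

end

section \<open>From the graph to the characteristic polynomial\<close>

lemma (in bipartite_minus_edge) char_poly_ecc_matrix:
  assumes a: "card U = a + 2" and b: "card V = b + 2"
  shows "char_poly (map_mat complex_of_real (ecc_matrix G)) =
    ([:2, 1:] ^ 2 * [:- 2 * of_nat (a + 1), 1:] * [:- 2 * of_nat (b + 1), 1:]
      - [:if d then 3 else 0:] ^ 2 * [:- 2 * of_nat a, 1:] * [:- 2 * of_nat b, 1:]) * [:2, 1:] ^ (a + b)"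
proof -
  obtain x' y' where o: "x' \<in> U" "x' \<noteq> x" "y' \<in> V" "y' \<noteq> y"
    by (rule others)
  obtain ys where ys: "set ys = verts G - {x, x', y, y'}" "distinct ys"
    using finite_distinct_list[of "verts G - {x, x', y, y'}"] finite_parts(3) by auto
  \<comment> \<open>This order puts the ends at 0 and 2 and the representatives at 1 and 3, as
    \<open>char_poly_linked_cliques\<close> expects.\<close>
  define xs where "xs = x # x' # y # y' # ys"
  define n where "n = card (verts G)"
  define s where "s i \<longleftrightarrow> xs ! i \<in> U" for i
  let ?c = "if d then 3 else 0 :: complex"
  have xs: "set xs = verts G" "distinct xs"
    using o xy disj ys by (auto simp: xs_def verts)
  then have len: "length xs = n"
    using distinct_card[of xs] by (simp add: n_def)
  have n: "n = (a + b) + 4"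
    unfolding n_def verts using card_Un_disjoint[OF finite_parts(1,2) disj] a b by simp
  have bij: "bij_betw ((!) xs) {..<n} (verts G)"
    using xs len by (intro bij_betw_nth) auto
  have inj: "inj_on ((!) xs) {..<n}" and im: "(!) xs ` {..<n} = verts G"
    using bij by (auto simp: bij_betw_def)
  have s: "s 0" "s 1" "\<not> s 2" "\<not> s 3"
    using o xy disj by (auto simp: s_def xs_def numeral_eq_Suc)
  have entry: "complex_of_real (ecc_entry G (xs ! i) (xs ! j)) = linked_cliques ?c s i j"
    if "i < n" "j < n" for i j
  proof -
    have "xs ! i \<in> verts G" "xs ! j \<in> verts G"
      using that im by auto
    moreover have "xs ! i = xs ! j \<longleftrightarrow> i = j"
      using that len xs(2) by (simp add: nth_eq_iff_index_eq)
    moreover have "xs ! k = x \<longleftrightarrow> k = 0" "xs ! k = y \<longleftrightarrow> k = 2" if "k < n" for k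
      using that len xs(2) nth_eq_iff_index_eq[of xs k 0] nth_eq_iff_index_eq[of xs k 2] n
      by (simp_all add: xs_def)
    then have "{xs ! i, xs ! j} = {x, y} \<longleftrightarrow> {i, j} = {0, 2}"
      using that by (simp add: doubleton_eq_iff)
    ultimately show ?thesis
      by (simp add: ecc_entry_eq linked_cliques_def s_def)
  qed
  have card_nth: "card {i \<in> {..<n}. xs ! i \<in> W} = card W" if "W \<subseteq> verts G" for W
  proof -
    have "(!) xs ` {i \<in> {..<n}. xs ! i \<in> W} = W"
    proof
      show "W \<subseteq> (!) xs ` {i \<in> {..<n}. xs ! i \<in> W}"
      proof
        fix w assume w: "w \<in> W"
        then have "w \<in> (!) xs ` {..<n}"
          using that im by auto
        then show "w \<in> (!) xs ` {i \<in> {..<n}. xs ! i \<in> W}"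
          using w by auto
      qed
    qed auto
    moreover have "inj_on ((!) xs) {i \<in> {..<n}. xs ! i \<in> W}"
      using inj by (rule inj_on_subset) auto
    ultimately show ?thesis
      using card_image by metis
  qed
  have less4: "i = 0 \<or> i = 1 \<or> i = 2 \<or> i = 3 \<or> 4 \<le> i" for i :: nat
    by arith
  have "i \<in> {i \<in> {..<n}. xs ! i \<in> U} \<longleftrightarrow> i \<in> {0, 1} \<union> {i \<in> {4..<n}. s i}" for i
    unfolding s_def[symmetric] using less4[of i] s n by auto
  then have "{i \<in> {..<n}. xs ! i \<in> U} = {0, 1} \<union> {i \<in> {4..<n}. s i}"
    by blast
  then have "card ({0, 1} \<union> {i \<in> {4..<n}. s i}) = a + 2"
    using card_nth[of U] a by (simp add: verts)
  then have card_a: "card {i \<in> {4..<n}. s i} = a"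
    by (subst (asm) card_Un_disjoint) auto
  have "xs ! i \<in> V \<longleftrightarrow> \<not> s i" if "i < n" for i
    using that im disj by (auto simp: s_def verts)
  then have "i \<in> {i \<in> {..<n}. xs ! i \<in> V} \<longleftrightarrow> i \<in> {2, 3} \<union> {i \<in> {4..<n}. \<not> s i}" for i
    using less4[of i] s n by auto
  then have "{i \<in> {..<n}. xs ! i \<in> V} = {2, 3} \<union> {i \<in> {4..<n}. \<not> s i}"
    by blast
  then have "card ({2, 3} \<union> {i \<in> {4..<n}. \<not> s i}) = b + 2"
    using card_nth[of V] b by (simp add: verts)
  then have card_b: "card {i \<in> {4..<n}. \<not> s i} = b"
    by (subst (asm) card_Un_disjoint) auto
  have "map_mat complex_of_real (ecc_matrix G) = mat n n (\<lambda>(i, j).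
      complex_of_real (ecc_entry G (from_nat_into (verts G) i) (from_nat_into (verts G) j)))"
    by (rule eq_matI) (auto simp: ecc_matrix_def n_def)
  then have "char_poly (map_mat complex_of_real (ecc_matrix G)) =
      char_poly (mat n n (\<lambda>(i, j). complex_of_real (ecc_entry G (xs ! i) (xs ! j))))"
    using char_poly_reindex[OF bij_betw_from_nat_into_finite[OF finite_parts(3), folded n_def] bij,
      of "\<lambda>u v. complex_of_real (ecc_entry G u v)"] by simp
  also have "mat n n (\<lambda>(i, j). complex_of_real (ecc_entry G (xs ! i) (xs ! j))) =
      mat n n (\<lambda>(i, j). linked_cliques ?c s i j)"
    by (rule eq_matI) (auto simp: entry)
  also note char_poly_linked_cliques[OF s card_a card_b n]
  finally show ?thesis .
qed

section \<open>Comparison of the two energies\<close>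

lemma ecc_energy_del_edge_gt:
  assumes wf: "wf_digraph G" and verts: "verts G = U \<union> V" "U \<inter> V = {}"
    and card: "card U \<ge> 2" "card V \<ge> 2"
    and ends: "arcs_ends G = U \<times> V \<union> V \<times> U"
    and e: "{tail G e, head G e} = {x, y}" and xy: "x \<in> U" "y \<in> V"
  shows "ecc_energy G < ecc_energy (del_edge G e)"
proof -
  let ?H = "del_edge G e"
  interpret G: wf_digraph G by (rule wf)
  \<comment> \<open>Both graphs instantiate one locale and differ only in the flag, so one
    computation of the characteristic polynomial serves both.\<close>
  interpret G: bipartite_minus_edge G U V x y False
    using assms by unfold_locales auto
  interpret H: bipartite_minus_edge ?H U V x y True
  proof unfold_locales
    have "{u, v} = {x, y} \<longleftrightarrow> (u, v) \<in> {(x, y), (y, x)}" for u v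
      by (auto simp: doubleton_eq_iff)
    then have "arcs_ends ?H = arcs_ends G - {(x, y), (y, x)}"
      unfolding arcs_ends_conv del_edge_def e by auto
    then show "arcs_ends ?H = U \<times> V \<union> V \<times> U - (if True then {(x, y), (y, x)} else {})"
      using ends by simp
  qed (use assms in \<open>auto simp: del_edge_def\<close>)
  obtain a b where a: "card U = a + 2" and b: "card V = b + 2"
    using card by (metis add.commute le_Suc_ex)
  have "ecc_energy G = 4 * real (a + b) + 8"
    unfolding ecc_energy_def
    using G.char_poly_ecc_matrix[OF a b]
    by (intro mat_energy_unlinked[where n = "card (verts G)"])
      (simp add: ecc_matrix_def, simp only: if_False pCons_0_0 zero_power2 mult_zero_left diff_zero)
  moreover have "ecc_energy ?H > 4 * real (a + b) + 8"
    unfolding ecc_energy_def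
    using H.char_poly_ecc_matrix[OF a b]
    by (intro mat_energy_linked[where n = "card (verts ?H)"])
      (simp add: ecc_matrix_def, simp only: if_True)
  ultimately show ?thesis by simp
qed

theorem theorem2p8:
  fixes G :: "('a, 'b) pre_digraph" and m n :: nat and e :: 'b
  assumes "m \<ge> 2" and "n \<ge> 2"
    and "complete_bipartite_digraph m n G"
    and "e \<in> arcs G"
  shows "ecc_energy G < ecc_energy (del_edge G e)"
proof -
  obtain U V where UV: "graph G" "verts G = U \<union> V" "U \<inter> V = {}" "card U = m" "card V = n"
      "arcs_ends G = U \<times> V \<union> V \<times> U"
    using assms(3) unfolding complete_bipartite_digraph_def by blast
  interpret graph G by (rule UV)
  have "(tail G e, head G e) \<in> arcs_ends G"
    using assms(4) by (simp add: arcs_ends_conv)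
  \<comment> \<open>The arc \<open>e\<close> may point either way; the end in \<open>U\<close> takes
    the role of \<open>x\<close>.\<close>
  then consider "tail G e \<in> U" "head G e \<in> V" | "head G e \<in> U" "tail G e \<in> V"
    using UV(6) by blast
  then show ?thesis
  proof cases
    case 1
    then show ?thesis
      using UV assms(1,2) by (intro ecc_energy_del_edge_gt[OF wf_digraph, of U V]) auto
  next
    case 2
    then show ?thesis
      using UV assms(1,2) by (intro ecc_energy_del_edge_gt[OF wf_digraph, of U V _ "head G e" "tail G e"]) auto
  qed
qed

end
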